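(* Let $[b_L,b_U]$, $[p_L,p_U]$, $[C_L,C_U]$ be compact intervals of positive real numbers with $p_L>1$. For all $k\in\mathbb{Z}$ let $b_k\in[b_L,b_U]$, $p_k\in[p_L,p_U]$ and $C_k\in[C_L,C_U]$, and put $\mathbf{b}=\{b_k:k\in\mathbb{Z}\}$. Let $\delta>0$ and let $\{a_k:k\in\mathbb{Z}\}\subset\mathbb{R}$ be a $\delta$-separated set. Let $\mathbf{h}=\{h_k\in L^2(\mathbb{R}):k\in\mathbb{Z}\}$ be such that $\mathcal{G}(\mathbf{h},\mathbf{b})$ is a nonstationary Gabor frame for $L^2(\mathbb{R})$ with frame bounds $A_h,B_h$. Let $\mathbf{g}=\{g_k\in L^2(\mathbb{R}):k\in\mathbb{Z}\}$ be a set of windows such that for all $k\in\mathbb{Z}$ and almost all $t\in\mathbb{R}$ $$|g_k(t)-h_k(t)|\le C_k(1+|t-a_k|)^{-p_k}.$$ Define $$E_1=1+\frac{\delta^{-1}+p_L}{(1+\delta)^{p_L}(p_L-1)},\qquad E_2=1+\frac{b_U+p_U}{(1+b_U^{-1})^{p_L}(p_L-1)},\qquad \lambda=4\,b_L^{-1}\,E_1\,E_2 .$$ If $C_U<\sqrt{A_h\lambda^{-1}}$, then $\mathcal{G}(\mathbf{g},\mathbf{b})$ is a frame for $L^2(\mathbb{R})$ with frame bounds $$A=A_h\Big(1-\sqrt{C_U^2\lambda A_h^{-1}}\Big)^2,\qquad B=B_h\Big(1+\sqrt{C_U^2\lambda B_h^{-1}}\Big)^2 .$$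
   Context: For $b\in\mathbb{R}$ let $M_b g(t)=e^{2\pi i b t}g(t)$. Given windows $\mathbf{g}=\{g_k\in L^2(\mathbb{R}):k\in\mathbb{Z}\}$ and positive frequency-shift parameters $\mathbf{b}=\{b_k:k\in\mathbb{Z}\}$, put $g_{k,l}=M_{b_k l}g_k$; the nonstationary Gabor system is $\mathcal{G}(\mathbf{g},\mathbf{b})=\{g_{k,l}:k,l\in\mathbb{Z}\}$. It is a (nonstationary Gabor) frame for $L^2(\mathbb{R})$ with frame bounds $A,B$, where $0<A\le B<\infty$, if $A\|f\|_2^2\le\sum_{k,l\in\mathbb{Z}}|\langle f,g_{k,l}\rangle|^2\le B\|f\|_2^2$ for all $f\in L^2(\mathbb{R})$. A set $\{a_k:k\in\mathbb{Z}\}\subset\mathbb{R}$ is $\delta$-separated if $|a_k-a_m|>\delta$ whenever $k\ne m$. *)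

theory Defs
  imports "HOL-Analysis.Analysis"
begin

text \<open>
  The library has no Lebesgue spaces, so elements of \<open>L\<^sup>2(\<real>)\<close> are represented by
  Lebesgue measurable complex functions rather than by classes modulo null sets; all notions
  below are invariant under changes on null sets.
\<close>

definition L2 :: "(real \<Rightarrow> complex) set" where
  "L2 = {f \<in> borel_measurable lebesgue. integrable lebesgue (\<lambda>t. (cmod (f t))\<^sup>2)}"

definition L2_norm :: "(real \<Rightarrow> complex) \<Rightarrow> real" where
  "L2_norm f = sqrt (LINT t|lebesgue. (cmod (f t))\<^sup>2)"

definition L2_inner :: "(real \<Rightarrow> complex) \<Rightarrow> (real \<Rightarrow> complex) \<Rightarrow> complex" where
  "L2_inner f g = (LINT t|lebesgue. f t * cnj (g t))"

definition modulation :: "real \<Rightarrow> (real \<Rightarrow> complex) \<Rightarrow> real \<Rightarrow> complex" where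
  "modulation b g = (\<lambda>t. exp (2 * complex_of_real pi * \<i> * complex_of_real (b * t)) * g t)"

definition nonstat_gabor_system ::
    "(int \<Rightarrow> real \<Rightarrow> complex) \<Rightarrow> (int \<Rightarrow> real) \<Rightarrow> int \<times> int \<Rightarrow> real \<Rightarrow> complex" where
  "nonstat_gabor_system g b = (\<lambda>(k, l). modulation (b k * of_int l) (g k))"

text \<open>
  Summability is required explicitly, since \<open>infsum\<close> is 0 on families that are not summable;
  it is what the finite upper bound says for a sum of nonnegative terms.
\<close>

definition is_frame_L2 :: "('i \<Rightarrow> real \<Rightarrow> complex) \<Rightarrow> real \<Rightarrow> real \<Rightarrow> bool" where
  "is_frame_L2 e A B \<longleftrightarrow>
     0 < A \<and> A \<le> B \<and> (\<forall>i. e i \<in> L2) \<and>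
     (\<forall>f\<in>L2.
        (\<lambda>i. (cmod (L2_inner f (e i)))\<^sup>2) summable_on UNIV \<and>
        A * (L2_norm f)\<^sup>2 \<le> (\<Sum>\<^sub>\<infinity>i. (cmod (L2_inner f (e i)))\<^sup>2) \<and>
        (\<Sum>\<^sub>\<infinity>i. (cmod (L2_inner f (e i)))\<^sup>2) \<le> B * (L2_norm f)\<^sup>2)"

definition separated :: "real \<Rightarrow> (int \<Rightarrow> real) \<Rightarrow> bool" where
  "separated \<delta> a \<longleftrightarrow> (\<forall>k m. k \<noteq> m \<longrightarrow> \<bar>a k - a m\<bar> > \<delta>)"

end

theory Submission
  imports Defs
begin

text \<open>
  The system of differences \<open>\<psi>\<^sub>k = g\<^sub>k - h\<^sub>k\<close> with the shifts \<open>b\<^sub>k\<close> is a Bessel sequence with bound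
  \<open>R = C\<^sub>U\<^sup>2 \<lambda> < A\<^sub>h\<close>, and then Minkowski's inequality in \<open>\<ell>\<^sup>2\<close> moves the square roots of the frame
  bounds of the old system by at most \<open>\<surd>R\<close>. For the Bessel bound let \<open>w\<^sub>k\<close> be the decaying majorant
  of \<open>\<bar>\<psi>\<^sub>k\<bar>\<close>. For fixed \<open>k\<close> the sum over \<open>l\<close> is at most
  \<open>b\<^sub>k\<^sup>-\<^sup>1 (sup \<Sum>\<^sub>n w\<^sub>k(t + n/b\<^sub>k)) \<integral> \<bar>f\<bar>\<^sup>2 w\<^sub>k\<close>, and summing over \<open>k\<close> leaves \<open>sup \<Sum>\<^sub>k w\<^sub>k(t)\<close>. Both suprema are
  sums of \<open>(1 + \<bar>t - x\<bar>)\<^sup>-\<^sup>p\<close> over a separated set of points \<open>x\<close>, which comparison with the integral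
  of \<open>(1 + d x)\<^sup>-\<^sup>p\<close> on each side of \<open>t\<close> bounds by \<open>2 E\<^sub>2\<close> and \<open>2 E\<^sub>1\<close> times \<open>C\<^sub>U\<close>.
\<close>

section \<open>Sums of polynomial decay over separated points\<close>

text \<open>This is the closed form of 1 + (1 + d)^(-p) plus the integral of (1 + d x)^(-p) over x
  from 1 to infinity. It equals \<open>E1\<close> for the arguments \<open>\<delta>\<close> and
  \<open>pL\<close>, and it gives \<open>E2\<close>, up to \<open>pU\<close> in place of
  \<open>pL\<close>, for \<open>inverse bU\<close> and \<open>pL\<close>.\<close>

definition decay_const :: "real \<Rightarrow> real \<Rightarrow> real" where
  "decay_const d p = 1 + (inverse d + p) / ((1 + d) powr p * (p - 1))"

text \<open>The right side is the integral of (p - 1) x^(-p) over [u, u + d], and the integrand is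
  smallest at the right end. The mean value theorem replaces the integration, and the differences
  telescope when summed.\<close>

lemma powr_integral_step:
  fixes u d p :: real
  assumes "0 < u" "0 < d" "1 < p"
  shows "d * (p - 1) * (u + d) powr (- p) \<le> u powr (1 - p) - (u + d) powr (1 - p)"
proof -
  have "\<exists>z>u. z < u + d \<and> (u + d) powr (1 - p) - u powr (1 - p)
      = (u + d - u) * ((1 - p) * z powr (1 - p - 1))"
    using assms by (intro MVT2) (auto intro!: derivative_eq_intros)
  then obtain z where z: "u < z" "z < u + d"
    "(u + d) powr (1 - p) - u powr (1 - p) = d * ((1 - p) * z powr (- p))"
    by auto
  have "(u + d) powr (- p) \<le> z powr (- p)"
    using z assms by (intro powr_mono2') auto
  then have "d * (p - 1) * (u + d) powr (- p) \<le> d * (p - 1) * z powr (- p)"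
    using assms by (intro mult_left_mono) auto
  also have "\<dots> = u powr (1 - p) - (u + d) powr (1 - p)"
    using z(3) by (simp add: algebra_simps)
  finally show ?thesis .
qed

lemma sum_decay_arith:
  fixes d p :: real
  assumes "0 < d" "1 < p"
  shows "(\<Sum>j\<le>n. (1 + real j * d) powr (- p)) \<le> decay_const d p"
proof -
  \<comment> \<open>The terms j = 0 and j = 1 are kept exactly; only those from j = 2 on are
    compared with the integral. The subtracted power is the tail of the integral, which makes the
    induction telescope and is dropped afterwards.\<close>
  have *: "(\<Sum>j\<le>Suc m. (1 + real j * d) powr (- p))
     \<le> 1 + (1 + d) powr (- p) + ((1 + d) powr (1 - p) - (1 + real (Suc m) * d) powr (1 - p)) / (d * (p - 1))"
    for m
  proof (induction m)
    case 0
    then show ?case by simp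
  next
    case (Suc m)
    have "(1 + real (Suc (Suc m)) * d) powr (- p)
        \<le> ((1 + real (Suc m) * d) powr (1 - p) - (1 + real (Suc (Suc m)) * d) powr (1 - p)) / (d * (p - 1))"
    proof -
      have "0 < 1 + real (Suc m) * d"
        using assms by (intro add_pos_nonneg) auto
      from powr_integral_step[OF this assms] show ?thesis
        using assms by (simp add: field_simps)
    qed
    with Suc show ?case
      by (simp add: diff_divide_distrib)
  qed
  have E: "1 + (1 + d) powr (- p) + (1 + d) powr (1 - p) / (d * (p - 1)) = decay_const d p"
  proof -
    have "(1 + d) powr (1 - p) = (1 + d) * (1 + d) powr (- p)"
      using assms powr_add[of "1 + d" 1 "- p"] by simp
    then show ?thesis
      unfolding decay_const_def using assms
      by (simp add: powr_minus field_simps)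
  qed
  \<comment> \<open>The telescoped bound starts with two terms, so the sum consisting of j = 0 alone
    is estimated separately.\<close>
  have D: "1 \<le> decay_const d p"
    unfolding decay_const_def using assms by simp
  show ?thesis
  proof (cases n)
    case 0
    then show ?thesis using D by simp
  next
    case (Suc m)
    have "(\<Sum>j\<le>n. (1 + real j * d) powr (- p))
       \<le> 1 + (1 + d) powr (- p) + ((1 + d) powr (1 - p) - (1 + real n * d) powr (1 - p)) / (d * (p - 1))"
      using *[of m] Suc by simp
    also have "\<dots> \<le> 1 + (1 + d) powr (- p) + (1 + d) powr (1 - p) / (d * (p - 1))"
      using assms by (intro add_left_mono divide_right_mono) auto
    finally show ?thesis using E by simp
  qed
qed

text \<open>Each half-open cell [j d, (j + 1) d) contains at most one of the points. Moving every
  point to the left end of its cell only increases the terms and leaves part of the sum over the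
  arithmetic progression.\<close>

lemma sum_decay_separated_nonneg:
  fixes x :: "'i \<Rightarrow> real"
  assumes "finite K" "0 < d" "1 < p"
    and nonneg: "\<And>k. k \<in> K \<Longrightarrow> 0 \<le> x k"
    and sep: "\<And>k m. k \<in> K \<Longrightarrow> m \<in> K \<Longrightarrow> k \<noteq> m \<Longrightarrow> d \<le> \<bar>x k - x m\<bar>"
  shows "(\<Sum>k\<in>K. (1 + x k) powr (- p)) \<le> decay_const d p"
proof -
  define r where "r k = nat \<lfloor>x k / d\<rfloor>" for k
  have r: "real (r k) \<le> x k / d" "x k / d < real (r k) + 1" if "k \<in> K" for k
    using nonneg[OF that] assms(2) by (auto simp: r_def)
  have inj: "inj_on r K"
  proof (rule inj_onI, rule ccontr)
    fix k m assume km: "k \<in> K" "m \<in> K" "r k = r m" "k \<noteq> m"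
    have "\<bar>x k / d - x m / d\<bar> < 1"
      using r[OF km(1)] r[OF km(2)] km(3) by auto
    then have "\<bar>x k - x m\<bar> < d"
      using assms(2) by (simp add: diff_divide_distrib[symmetric])
    with sep[OF km(1,2,4)] show False by simp
  qed
  obtain n where n: "r ` K \<subseteq> {..n}"
    using finite_nat_iff_bounded_le assms(1) by blast
  have "(\<Sum>k\<in>K. (1 + x k) powr (- p)) \<le> (\<Sum>k\<in>K. (1 + real (r k) * d) powr (- p))"
    using r assms(2,3)
    by (intro sum_mono powr_mono2') (auto simp: field_simps add_pos_nonneg)
  also have "\<dots> = (\<Sum>j\<in>r ` K. (1 + real j * d) powr (- p))"
    using inj by (simp add: sum.reindex)
  also have "\<dots> \<le> (\<Sum>j\<le>n. (1 + real j * d) powr (- p))"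
    using n by (intro sum_mono2) auto
  also have "\<dots> \<le> decay_const d p"
    using assms(2,3) by (rule sum_decay_arith)
  finally show ?thesis .
qed

text \<open>The one-sided bound applies to the points on the left and on the right of
  \<open>t\<close>, whence the factor 2. The lemma is used once for the centres and once for the
  translates of a window, which yields the 4 in \<open>lam\<close>.\<close>

lemma sum_decay_separated:
  fixes a :: "'i \<Rightarrow> real"
  assumes "finite K" "0 < d" "1 < p"
    and sep: "\<And>k m. k \<in> K \<Longrightarrow> m \<in> K \<Longrightarrow> k \<noteq> m \<Longrightarrow> d \<le> \<bar>a k - a m\<bar>"
  shows "(\<Sum>k\<in>K. (1 + \<bar>t - a k\<bar>) powr (- p)) \<le> 2 * decay_const d p"
proof -
  let ?L = "{k \<in> K. a k \<le> t}" and ?R = "{k \<in> K. t < a k}"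
  have "(\<Sum>k\<in>K. (1 + \<bar>t - a k\<bar>) powr (- p))
      = (\<Sum>k\<in>?L \<union> ?R. (1 + \<bar>t - a k\<bar>) powr (- p))"
    by (rule sum.cong) auto
  also have "\<dots> = (\<Sum>k\<in>?L. (1 + \<bar>t - a k\<bar>) powr (- p)) + (\<Sum>k\<in>?R. (1 + \<bar>t - a k\<bar>) powr (- p))"
    using assms(1) by (intro sum.union_disjoint) auto
  also have "\<dots> = (\<Sum>k\<in>?L. (1 + (t - a k)) powr (- p)) + (\<Sum>k\<in>?R. (1 + (a k - t)) powr (- p))"
    by (intro arg_cong2[where f = "(+)"] sum.cong) auto
  also have "\<dots> \<le> decay_const d p + decay_const d p"
    using assms(1-3) sep
    by (intro add_mono sum_decay_separated_nonneg) (auto simp: abs_minus_commute)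
  finally show ?thesis by simp
qed

section \<open>Periodization of a weighted integral\<close>

text \<open>The line is cut into intervals of length \<open>P\<close>, and each piece is translated
  to [0, P]. The factor \<open>q\<close> does not notice the translation, so only the translates of
  \<open>w\<close> are summed, and their sum is at most \<open>S\<close>.\<close>

lemma nn_integral_periodic_weight_le:
  fixes q w :: "real \<Rightarrow> real"
  assumes [measurable]: "q \<in> borel_measurable borel" "w \<in> borel_measurable borel"
    and q: "\<And>t. 0 \<le> q t" and w: "\<And>t. 0 \<le> w t"
    and "0 < P" and per: "\<And>t (n::int). q (t + of_int n * P) = q t"
    and S: "\<And>t (N::int set). finite N \<Longrightarrow> (\<Sum>n\<in>N. w (t + of_int n * P)) \<le> S"
  shows "(\<integral>\<^sup>+t. ennreal (q t * w t) \<partial>lborel)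
      \<le> ennreal S * (\<integral>\<^sup>+t. ennreal (indicator {0..P} t * q t) \<partial>lborel)"
proof -
  have S0: "0 \<le> S" using S[of "{}"] by simp
  have per': "q (t + P * of_int n) = q t" for t and n :: int
    using per[of t n] by (simp add: mult.commute)
  define I where "I n = {real_of_int n * P..(of_int n + 1) * P}" for n :: int
  \<comment> \<open>Enumerating the integers by naturals turns the sum over all periods into a
    series, which may be interchanged with the integral.\<close>
  define D where "D = int_decode"
  have [measurable]: "I n \<in> sets borel" for n by (simp add: I_def)
  \<comment> \<open>The closed intervals share end points, where the series may count a value twice;
    an inequality is all that is needed.\<close>
  have "(\<integral>\<^sup>+t. ennreal (q t * w t) \<partial>lborel)
     \<le> (\<integral>\<^sup>+t. (\<Sum>i. ennreal (indicator (I (D i)) t * (q t * w t))) \<partial>lborel)"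
  proof (rule nn_integral_mono)
    fix t
    define n where "n = \<lfloor>t / P\<rfloor>"
    have "t \<in> I n"
      using floor_divide_lower[OF \<open>0 < P\<close>, of t] floor_divide_upper[OF \<open>0 < P\<close>, of t]
      by (auto simp: I_def n_def)
    then have "ennreal (q t * w t) = (\<Sum>i\<in>{int_encode n}. ennreal (indicator (I (D i)) t * (q t * w t)))"
      by (simp add: D_def)
    also have "\<dots> \<le> (\<Sum>i. ennreal (indicator (I (D i)) t * (q t * w t)))"
      by (rule sum_le_suminf) auto
    finally show "ennreal (q t * w t) \<le> (\<Sum>i. ennreal (indicator (I (D i)) t * (q t * w t)))" .
  qed
  also have "\<dots> = (\<Sum>i. \<integral>\<^sup>+t. ennreal (indicator (I (D i)) t * (q t * w t)) \<partial>lborel)"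
    by (rule nn_integral_suminf) auto
  also have "\<dots> = (\<Sum>i. \<integral>\<^sup>+t. ennreal (indicator {0..P} t * (q t * w (t + of_int (D i) * P))) \<partial>lborel)"
  proof (rule suminf_cong)
    fix i
    have "(\<integral>\<^sup>+t. ennreal (indicator (I (D i)) t * (q t * w t)) \<partial>lborel)
        = ennreal \<bar>1\<bar> * (\<integral>\<^sup>+t. ennreal (indicator (I (D i)) (of_int (D i) * P + 1 * t) *
           (q (of_int (D i) * P + 1 * t) * w (of_int (D i) * P + 1 * t))) \<partial>lborel)"
      by (rule nn_integral_real_affine) auto
    also have "\<dots> = (\<integral>\<^sup>+t. ennreal (indicator {0..P} t * (q t * w (t + of_int (D i) * P))) \<partial>lborel)"
      by (auto intro!: nn_integral_cong simp: I_def indicator_def per' algebra_simps)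
    finally show "(\<integral>\<^sup>+t. ennreal (indicator (I (D i)) t * (q t * w t)) \<partial>lborel)
        = (\<integral>\<^sup>+t. ennreal (indicator {0..P} t * (q t * w (t + of_int (D i) * P))) \<partial>lborel)" .
  qed
  also have "\<dots> = (\<integral>\<^sup>+t. (\<Sum>i. ennreal (indicator {0..P} t * (q t * w (t + of_int (D i) * P)))) \<partial>lborel)"
    by (rule nn_integral_suminf[symmetric]) auto
  also have "\<dots> \<le> (\<integral>\<^sup>+t. ennreal S * ennreal (indicator {0..P} t * q t) \<partial>lborel)"
  proof (rule nn_integral_mono, rule suminf_le_const)
    fix t n
    have "(\<Sum>i<n. indicator {0..P} t * (q t * w (t + of_int (D i) * P)))
        = indicator {0..P} t * q t * (\<Sum>j\<in>D ` {..<n}. w (t + of_int j * P))"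
      by (simp add: sum.reindex inj_int_decode D_def sum_distrib_left mult_ac)
    also have "\<dots> \<le> indicator {0..P} t * q t * S"
      using q by (intro mult_left_mono S) auto
    finally show "(\<Sum>i<n. ennreal (indicator {0..P} t * (q t * w (t + of_int (D i) * P))))
        \<le> ennreal S * ennreal (indicator {0..P} t * q t)"
      using q w S0 by (subst sum_ennreal) (auto simp: ennreal_mult[symmetric] mult_ac intro!: ennreal_leI)
  qed auto
  also have "\<dots> = ennreal S * (\<integral>\<^sup>+t. ennreal (indicator {0..P} t * q t) \<partial>lborel)"
    by (rule nn_integral_cmult) auto
  finally show ?thesis .
qed

section \<open>Square-integrable functions and modulations\<close>

lemma modulation_eq_cis: "modulation b g t = cis (2 * pi * b * t) * g t"
  by (simp add: modulation_def cis_conv_exp mult_ac)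

lemma modulation_in_L2:
  assumes "g \<in> L2"
  shows "modulation b g \<in> L2"
proof -
  have [measurable]: "g \<in> borel_measurable lebesgue"
    using assms by (simp add: L2_def)
  have "(\<lambda>t. cis (2 * pi * b * t)) \<in> borel_measurable borel"
    by (intro borel_measurable_continuous_onI continuous_intros)
  then have [measurable]: "(\<lambda>t. cis (2 * pi * b * t)) \<in> borel_measurable lebesgue"
    by (intro measurable_completion) simp
  have "(\<lambda>t. cis (2 * pi * b * t) * g t) \<in> borel_measurable lebesgue"
    by measurable
  then show ?thesis
    using assms by (simp add: L2_def modulation_eq_cis[abs_def] norm_mult)
qed

lemma modulation_diff: "modulation b (\<lambda>t. g t - h t) = (\<lambda>t. modulation b g t - modulation b h t)"
  by (simp add: modulation_def algebra_simps)

lemma L2_diff: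
  assumes "f \<in> L2" "g \<in> L2"
  shows "(\<lambda>t. f t - g t) \<in> L2"
proof -
  have [measurable]: "f \<in> borel_measurable lebesgue" "g \<in> borel_measurable lebesgue"
    using assms by (auto simp: L2_def)
  have "integrable lebesgue (\<lambda>t. 2 * (cmod (f t))\<^sup>2 + 2 * (cmod (g t))\<^sup>2)"
    using assms by (auto simp: L2_def)
  then have "integrable lebesgue (\<lambda>t. (cmod (f t - g t))\<^sup>2)"
  proof (rule Bochner_Integration.integrable_bound)
    show "AE t in lebesgue. norm ((cmod (f t - g t))\<^sup>2)
        \<le> norm (2 * (cmod (f t))\<^sup>2 + 2 * (cmod (g t))\<^sup>2)"
    proof (rule AE_I2)
      fix t
      have "(cmod (f t - g t))\<^sup>2 \<le> (cmod (f t) + cmod (g t))\<^sup>2"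
        by (intro power_mono norm_triangle_ineq4) auto
      also have "\<dots> \<le> 2 * (cmod (f t))\<^sup>2 + 2 * (cmod (g t))\<^sup>2"
        using sum_squares_bound[of "cmod (f t)" "cmod (g t)"] by (simp add: power2_sum)
      finally show "norm ((cmod (f t - g t))\<^sup>2) \<le> norm (2 * (cmod (f t))\<^sup>2 + 2 * (cmod (g t))\<^sup>2)"
        by simp
    qed
  qed measurable
  then show ?thesis by (simp add: L2_def)
qed

lemma integrable_L2_weight:
  fixes w :: "real \<Rightarrow> real"
  assumes "f \<in> L2" "w \<in> borel_measurable borel" "\<And>t. 0 \<le> w t" "\<And>t. w t \<le> W"
  shows "integrable lebesgue (\<lambda>t. (cmod (f t))\<^sup>2 * w t)"
proof (rule Bochner_Integration.integrable_bound)
  have [measurable]: "f \<in> borel_measurable lebesgue" "w \<in> borel_measurable lebesgue"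
    using assms by (auto simp: L2_def intro: measurable_completion)
  show "(\<lambda>t. (cmod (f t))\<^sup>2 * w t) \<in> borel_measurable lebesgue" by measurable
  show "integrable lebesgue (\<lambda>t. (cmod (f t))\<^sup>2 * W)"
    using assms by (simp add: L2_def)
  show "AE t in lebesgue. norm ((cmod (f t))\<^sup>2 * w t) \<le> norm ((cmod (f t))\<^sup>2 * W)"
  proof (rule AE_I2)
    fix t
    have "(cmod (f t))\<^sup>2 * w t \<le> (cmod (f t))\<^sup>2 * W"
      using assms by (intro mult_left_mono) auto
    then show "norm ((cmod (f t))\<^sup>2 * w t) \<le> norm ((cmod (f t))\<^sup>2 * W)"
      using assms(3)[of t] assms(4)[of t] by simp
  qed
qed

lemma integrable_L2_inner:
  assumes "f \<in> L2" "g \<in> L2"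
  shows "integrable lebesgue (\<lambda>t. f t * cnj (g t))"
proof -
  have [measurable]: "f \<in> borel_measurable lebesgue" "g \<in> borel_measurable lebesgue"
    using assms by (auto simp: L2_def)
  have [measurable]: "cnj \<in> borel_measurable borel"
    by (intro borel_measurable_continuous_onI continuous_intros)
  have "integrable lebesgue (\<lambda>t. (cmod (f t))\<^sup>2 + (cmod (g t))\<^sup>2)"
    using assms by (auto simp: L2_def)
  then show ?thesis
  proof (rule Bochner_Integration.integrable_bound)
    show "AE t in lebesgue. norm (f t * cnj (g t)) \<le> norm ((cmod (f t))\<^sup>2 + (cmod (g t))\<^sup>2)"
    proof (rule AE_I2)
      fix t
      have "0 \<le> cmod (f t) * cmod (g t)" by simp
      then have "cmod (f t) * cmod (g t) \<le> (cmod (f t))\<^sup>2 + (cmod (g t))\<^sup>2"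
        using sum_squares_bound[of "cmod (f t)" "cmod (g t)"] by linarith
      then show "norm (f t * cnj (g t)) \<le> norm ((cmod (f t))\<^sup>2 + (cmod (g t))\<^sup>2)"
        by (simp add: norm_mult)
    qed
  qed measurable
qed

lemma L2_inner_diff_right:
  assumes "f \<in> L2" "g \<in> L2" "h \<in> L2"
  shows "L2_inner f (\<lambda>t. g t - h t) = L2_inner f g - L2_inner f h"
  unfolding L2_inner_def using assms
  by (simp add: algebra_simps integrable_L2_inner)

lemma L2_norm_nonneg: "0 \<le> L2_norm f"
  by (simp add: L2_norm_def)

lemma L2_norm_square: "(L2_norm f)\<^sup>2 = (LINT t|lebesgue. (cmod (f t))\<^sup>2)"
  by (simp add: L2_norm_def)

section \<open>Orthogonality of characters over one period\<close>

text \<open>For nonzero \<open>n\<close> the antiderivative takes equal values at both ends of the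
  interval, because \<open>c * inverse b\<close> is an integer multiple of 2 pi.\<close>

lemma has_integral_character:
  assumes "0 < b"
  shows "((\<lambda>t. cis (2 * pi * b * of_int n * t)) has_integral
            (if n = 0 then of_real (inverse b) else 0)) {0..inverse b}"
proof (cases "n = 0")
  case True
  then show ?thesis
    using assms has_integral_const_real[of "1::complex" 0 "inverse b"]
    by (simp add: scaleR_conv_of_real)
next
  case False
  define c where "c = 2 * pi * b * of_int n"
  define G where "G z = exp (\<i> * of_real c * z) / (\<i> * of_real c)" for z
  have "c \<noteq> 0" using False assms by (simp add: c_def)
  have *: "((\<lambda>t. G (of_real t)) has_vector_derivative cis (c * t)) (at t within {0..inverse b})" for t
  proof (rule has_vector_derivative_real_field)
    show "(G has_field_derivative cis (c * t)) (at (complex_of_real t))"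
      unfolding G_def using \<open>c \<noteq> 0\<close>
      by (auto intro!: derivative_eq_intros simp: cis_conv_exp mult_ac)
  qed
  have "((\<lambda>t. cis (c * t)) has_integral (G (of_real (inverse b)) - G (of_real 0))) {0..inverse b}"
    by (rule fundamental_theorem_of_calculus) (use assms * in auto)
  moreover have "exp (\<i> * of_real c * of_real (inverse b)) = 1"
  proof -
    have "c * inverse b = 2 * pi * of_int n" using assms by (simp add: c_def)
    then have "exp (\<i> * of_real c * of_real (inverse b)) = cis (2 * pi * of_int n)"
      unfolding cis_conv_exp by (metis mult.assoc of_real_mult)
    then show ?thesis by (simp add: cis_multiple_2pi)
  qed
  ultimately show ?thesis using False by (simp add: G_def c_def)
qed

text \<open>This is Parseval's identity for finite sums: the square expands into a double sum of
  characters, of which orthogonality leaves the diagonal.\<close>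

lemma has_integral_trig_poly_square:
  assumes "0 < b" "finite L"
  shows "((\<lambda>t. (cmod (\<Sum>l\<in>L. d l * cis (2 * pi * b * of_int l * t)))\<^sup>2) has_integral
            inverse b * (\<Sum>l\<in>L. (cmod (d l))\<^sup>2)) {0..inverse b}"
proof -
  let ?T = "\<lambda>t. \<Sum>l\<in>L. d l * cis (2 * pi * b * of_int l * t)"
  let ?c = "\<lambda>n. if n = 0 then complex_of_real (inverse b) else 0"
  have "((\<lambda>t. \<Sum>l\<in>L. \<Sum>m\<in>L. (d l * cnj (d m)) * cis (2 * pi * b * of_int (l - m) * t)) has_integral
      (\<Sum>l\<in>L. \<Sum>m\<in>L. (d l * cnj (d m)) * ?c (l - m))) {0..inverse b}"
    by (intro has_integral_sum has_integral_mult_right has_integral_character assms)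
  moreover have "(\<Sum>l\<in>L. \<Sum>m\<in>L. (d l * cnj (d m)) * cis (2 * pi * b * of_int (l - m) * t))
      = ?T t * cnj (?T t)" for t
  proof -
    have "cis (2 * pi * b * of_int (l - m) * t)
        = cis (2 * pi * b * of_int l * t) * cnj (cis (2 * pi * b * of_int m * t))" for l m :: int
      by (simp add: cis_cnj cis_mult algebra_simps)
    then show ?thesis by (simp add: sum_product mult_ac)
  qed
  moreover have "(\<Sum>l\<in>L. \<Sum>m\<in>L. (d l * cnj (d m)) * ?c (l - m))
      = of_real (inverse b * (\<Sum>l\<in>L. (cmod (d l))\<^sup>2))"
  proof -
    have "(\<Sum>m\<in>L. (d l * cnj (d m)) * ?c (l - m)) = of_real (inverse b * (cmod (d l))\<^sup>2)"
      if "l \<in> L" for l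
    proof -
      have "(\<Sum>m\<in>L. (d l * cnj (d m)) * ?c (l - m))
          = (\<Sum>m\<in>L. if l = m then (d l * cnj (d l)) * of_real (inverse b) else 0)"
        by (intro sum.cong) auto
      then show ?thesis
        using that assms(2) by (simp add: complex_norm_square[symmetric] mult_ac)
    qed
    then show ?thesis by (simp add: sum_distrib_left)
  qed
  ultimately have "((\<lambda>t. ?T t * cnj (?T t)) has_integral
      of_real (inverse b * (\<Sum>l\<in>L. (cmod (d l))\<^sup>2))) {0..inverse b}"
    by simp
  from has_integral_linear[OF this bounded_linear_Re] show ?thesis
    by (simp only: o_def complex_norm_square[symmetric] Re_complex_of_real)
qed

section \<open>Bessel bounds for modulates of dominated windows\<close>

text \<open>
  Duality replaces the Parseval identity for the periodization of \<open>f * cnj \<psi>\<close>: pairing the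
  coefficients with themselves gives \<open>D = \<integral> f * cnj (T * \<psi>)\<close> for a trigonometric polynomial \<open>T\<close>,
  so that only the nonnegative function \<open>\<bar>T\<bar>\<^sup>2 w\<close> has to be periodized.
\<close>

lemma modulates_bessel_weighted:
  fixes w :: "real \<Rightarrow> real"
  assumes "0 < b" "0 < S" "f \<in> L2" "\<psi> \<in> L2" "finite L"
    and w: "continuous_on UNIV w" "\<And>t. 0 \<le> w t" "\<And>t. w t \<le> W"
    and S: "\<And>t (N::int set). finite N \<Longrightarrow> (\<Sum>n\<in>N. w (t + of_int n * inverse b)) \<le> S"
    and dom: "AE t in lebesgue. cmod (\<psi> t) \<le> w t"
  shows "(\<Sum>l\<in>L. (cmod (L2_inner f (modulation (b * of_int l) \<psi>)))\<^sup>2)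
      \<le> S * inverse b * (LINT t|lebesgue. (cmod (f t))\<^sup>2 * w t)"
proof -
  define d where "d l = L2_inner f (modulation (b * of_int l) \<psi>)" for l :: int
  define D where "D = (\<Sum>l\<in>L. (cmod (d l))\<^sup>2)"
  define T where "T t = (\<Sum>l\<in>L. d l * cis (2 * pi * b * of_int l * t))" for t
  define J where "J = (LINT t|lebesgue. (cmod (f t))\<^sup>2 * w t)"
  \<comment> \<open>Periodization contributes \<open>S\<close> and Parseval contributes
    \<open>inverse b\<close>, so \<open>s * D\<close> bounds the integral of |T|^2 w.\<close>
  define s where "s = S * inverse b"
  have "0 < s" using assms by (simp add: s_def)
  have "0 \<le> D" by (simp add: D_def sum_nonneg)
  have [measurable]: "w \<in> borel_measurable borel" "T \<in> borel_measurable borel"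
    unfolding T_def using w by (auto intro!: borel_measurable_continuous_onI continuous_intros)
  then have [measurable]: "w \<in> borel_measurable lebesgue" "T \<in> borel_measurable lebesgue"
    by (auto intro!: measurable_completion)
  have [measurable]: "f \<in> borel_measurable lebesgue" "\<psi> \<in> borel_measurable lebesgue"
    using assms by (auto simp: L2_def)

  have T_per: "T (t + of_int n * inverse b) = T t" for t and n :: int
  proof -
    have "cis (2 * pi * b * of_int l * (t + of_int n * inverse b)) = cis (2 * pi * b * of_int l * t)"
      for l :: int
    proof -
      have "2 * pi * b * of_int l * (t + of_int n * inverse b)
          = 2 * pi * b * of_int l * t + 2 * pi * of_int (l * n)"
        using assms(1) by (simp add: field_simps)
      then show ?thesis
        by (simp only: cis_mult[symmetric] cis_multiple_2pi Ints_of_int mult_1_right)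
    qed
    then show ?thesis by (simp add: T_def)
  qed
  have "(\<integral>\<^sup>+t. ennreal ((cmod (T t))\<^sup>2 * w t) \<partial>lborel)
      \<le> ennreal S * (\<integral>\<^sup>+t. ennreal (indicator {0..inverse b} t * (cmod (T t))\<^sup>2) \<partial>lborel)"
    by (rule nn_integral_periodic_weight_le) (use w S assms(1) T_per in auto)
  also have "(\<integral>\<^sup>+t. ennreal (indicator {0..inverse b} t * (cmod (T t))\<^sup>2) \<partial>lborel) = ennreal (inverse b * D)"
    unfolding T_def D_def using assms(1,5)
    by (intro nn_integral_has_integral_lebesgue has_integral_trig_poly_square) auto
  also have "ennreal S * ennreal (inverse b * D) = ennreal (s * D)"
    using assms(1,2) \<open>0 \<le> D\<close> by (simp add: ennreal_mult[symmetric] s_def mult_ac)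
  \<comment> \<open>The integrand is Borel measurable, so passing to the completed measure does not
    change its integral.\<close>
  finally have Tw: "(\<integral>\<^sup>+t. ennreal ((cmod (T t))\<^sup>2 * w t) \<partial>lebesgue) \<le> ennreal (s * D)"
    by (simp add: nn_integral_completion)
  have Tw_int: "integrable lebesgue (\<lambda>t. (cmod (T t))\<^sup>2 * w t)"
  proof (rule integrableI_bounded)
    have "(\<integral>\<^sup>+t. ennreal (norm ((cmod (T t))\<^sup>2 * w t)) \<partial>lebesgue)
        = (\<integral>\<^sup>+t. ennreal ((cmod (T t))\<^sup>2 * w t) \<partial>lebesgue)"
      using w by (intro nn_integral_cong) auto
    also have "\<dots> < \<infinity>" using Tw by (rule le_less_trans) simp
    finally show "(\<integral>\<^sup>+t. ennreal (norm ((cmod (T t))\<^sup>2 * w t)) \<partial>lebesgue) < \<infinity>" .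
  qed measurable
  have Tw_le: "(LINT t|lebesgue. (cmod (T t))\<^sup>2 * w t) \<le> s * D"
  proof -
    have "ennreal (LINT t|lebesgue. (cmod (T t))\<^sup>2 * w t) \<le> ennreal (s * D)"
      using Tw w by (subst nn_integral_eq_integral[symmetric]) (auto simp: Tw_int)
    then show ?thesis using \<open>0 < s\<close> \<open>0 \<le> D\<close> by (simp add: ennreal_le_iff)
  qed
  have fw_int: "integrable lebesgue (\<lambda>t. (cmod (f t))\<^sup>2 * w t)"
    using assms(3) w by (intro integrable_L2_weight) auto

  have int: "integrable lebesgue (\<lambda>t. f t * cnj (modulation (b * of_int l) \<psi> t))" for l :: int
    using assms by (intro integrable_L2_inner modulation_in_L2)
  have int_T: "integrable lebesgue (\<lambda>t. f t * cnj (T t * \<psi> t))"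
    and D_eq: "(LINT t|lebesgue. f t * cnj (T t * \<psi> t)) = of_real D"
  proof -
    have *: "f t * cnj (T t * \<psi> t)
        = (\<Sum>l\<in>L. cnj (d l) * (f t * cnj (modulation (b * of_int l) \<psi> t)))" for t
      by (simp add: T_def modulation_eq_cis sum_distrib_left sum_distrib_right mult_ac)
    show "integrable lebesgue (\<lambda>t. f t * cnj (T t * \<psi> t))"
      unfolding * using int by (intro Bochner_Integration.integrable_sum integrable_mult_right) auto
    have "(LINT t|lebesgue. f t * cnj (T t * \<psi> t)) = (\<Sum>l\<in>L. cnj (d l) * d l)"
      unfolding * using int by (simp add: d_def L2_inner_def)
    also have "\<dots> = of_real D"
      by (simp add: D_def complex_norm_square[symmetric] mult.commute)
    finally show "(LINT t|lebesgue. f t * cnj (T t * \<psi> t)) = of_real D" .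
  qed
  have "D = norm (LINT t|lebesgue. f t * cnj (T t * \<psi> t))"
    using \<open>0 \<le> D\<close> by (simp only: D_eq norm_of_real abs_of_nonneg)
  also have "\<dots> \<le> (LINT t|lebesgue. norm (f t * cnj (T t * \<psi> t)))"
    by (rule integral_norm_bound)
  also have "\<dots> \<le> (LINT t|lebesgue. (s * ((cmod (f t))\<^sup>2 * w t) + inverse s * ((cmod (T t))\<^sup>2 * w t)) / 2)"
  proof (rule integral_mono_AE)
    show "integrable lebesgue (\<lambda>t. norm (f t * cnj (T t * \<psi> t)))"
      using int_T by (rule integrable_norm)
    show "integrable lebesgue (\<lambda>t. (s * ((cmod (f t))\<^sup>2 * w t) + inverse s * ((cmod (T t))\<^sup>2 * w t)) / 2)"
      using fw_int Tw_int by simp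
    show "AE t in lebesgue. norm (f t * cnj (T t * \<psi> t))
        \<le> (s * ((cmod (f t))\<^sup>2 * w t) + inverse s * ((cmod (T t))\<^sup>2 * w t)) / 2"
      using dom
    proof eventually_elim
      fix t assume t: "cmod (\<psi> t) \<le> w t"
      \<comment> \<open>AM-GM; the weight \<open>s\<close> is chosen so that the second term integrates to at most \<open>D / 2\<close>
        and is absorbed on the left.\<close>
      let ?x = "cmod (f t)" and ?y = "cmod (T t)"
      have "2 * (?x * ?y) \<le> s * ?x\<^sup>2 + inverse s * ?y\<^sup>2"
      proof -
        have "0 \<le> inverse s * (s * ?x - ?y)\<^sup>2" using \<open>0 < s\<close> by simp
        also have "\<dots> = s * ?x\<^sup>2 + inverse s * ?y\<^sup>2 - 2 * (?x * ?y)"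
          using \<open>0 < s\<close> by (simp add: power2_eq_square field_simps)
        finally show ?thesis by simp
      qed
      then have "2 * (?x * ?y) * w t \<le> (s * ?x\<^sup>2 + inverse s * ?y\<^sup>2) * w t"
        using w by (intro mult_right_mono) auto
      moreover have "norm (f t * cnj (T t * \<psi> t)) \<le> ?x * ?y * w t"
        using mult_left_mono[OF t, of "?x * ?y"] by (simp add: norm_mult mult_ac)
      ultimately show "norm (f t * cnj (T t * \<psi> t))
          \<le> (s * (?x\<^sup>2 * w t) + inverse s * (?y\<^sup>2 * w t)) / 2"
        by (simp add: algebra_simps)
    qed
  qed
  also have "\<dots> = (s * J + inverse s * (LINT t|lebesgue. (cmod (T t))\<^sup>2 * w t)) / 2"
    using fw_int Tw_int by (simp add: J_def)
  also have "\<dots> \<le> (s * J + inverse s * (s * D)) / 2"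
    using Tw_le \<open>0 < s\<close> by (intro divide_right_mono add_left_mono mult_left_mono) auto
  also have "inverse s * (s * D) = D" using \<open>0 < s\<close> by simp
  finally have "D \<le> s * J" by simp
  then show ?thesis by (simp add: D_def d_def s_def J_def)
qed

text \<open>Enlarging \<open>F\<close> to a product set lets the bound for a single window act on
  each row. After \<open>inverse (b k)\<close> is replaced by \<open>inverse bL\<close>, the finite
  sum over \<open>k\<close> moves under the integral and meets the bound \<open>S'\<close>.\<close>

lemma modulates_bessel_family:
  fixes w :: "'k \<Rightarrow> real \<Rightarrow> real" and \<psi> :: "'k \<Rightarrow> real \<Rightarrow> complex" and b :: "'k \<Rightarrow> real"
  assumes "0 < bL" "\<And>k. bL \<le> b k" "0 < S" "f \<in> L2" "\<And>k. \<psi> k \<in> L2" "finite F"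
    and w: "\<And>k. continuous_on UNIV (w k)" "\<And>k t. 0 \<le> w k t"
    and S: "\<And>k t (N::int set). finite N \<Longrightarrow> (\<Sum>n\<in>N. w k (t + of_int n * inverse (b k))) \<le> S"
    and S': "\<And>t K. finite K \<Longrightarrow> (\<Sum>k\<in>K. w k t) \<le> S'"
    and dom: "\<And>k. AE t in lebesgue. cmod (\<psi> k t) \<le> w k t"
  shows "(\<Sum>(k, l)\<in>F. (cmod (L2_inner f (modulation (b k * of_int l) (\<psi> k))))\<^sup>2)
      \<le> inverse bL * S * S' * (L2_norm f)\<^sup>2"
proof -
  define K where "K = fst ` F"
  define L where "L = snd ` F"
  have fin: "finite K" "finite L" using assms(6) by (auto simp: K_def L_def)
  have "F \<subseteq> K \<times> L" by (force simp: K_def L_def)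
  define J where "J k = (LINT t|lebesgue. (cmod (f t))\<^sup>2 * w k t)" for k
  \<comment> \<open>A one-element sum shows that each weight is bounded, which makes |f|^2 w
    integrable.\<close>
  have wS: "w k t \<le> S'" for k t
    using S'[of "{k}" t] by simp
  have J0: "0 \<le> J k" for k
    unfolding J_def using w by (intro integral_nonneg_AE) auto
  have f_int: "integrable lebesgue (\<lambda>t. (cmod (f t))\<^sup>2 * c)" for c
    using assms(4) by (simp add: L2_def)
  have fw_int: "integrable lebesgue (\<lambda>t. (cmod (f t))\<^sup>2 * w k t)" for k
    using assms(4) w wS by (intro integrable_L2_weight) (auto intro: borel_measurable_continuous_onI)
  have "(\<Sum>(k, l)\<in>F. (cmod (L2_inner f (modulation (b k * of_int l) (\<psi> k))))\<^sup>2)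
      \<le> (\<Sum>(k, l)\<in>K \<times> L. (cmod (L2_inner f (modulation (b k * of_int l) (\<psi> k))))\<^sup>2)"
    using fin \<open>F \<subseteq> K \<times> L\<close> by (intro sum_mono2) auto
  also have "\<dots> = (\<Sum>k\<in>K. \<Sum>l\<in>L. (cmod (L2_inner f (modulation (b k * of_int l) (\<psi> k))))\<^sup>2)"
    by (simp add: sum.cartesian_product)
  also have "\<dots> \<le> (\<Sum>k\<in>K. S * inverse (b k) * J k)"
    unfolding J_def
    by (intro sum_mono modulates_bessel_weighted[where W = S'])
      (use assms wS fin less_le_trans[OF assms(1,2)] in auto)
  also have "\<dots> \<le> (\<Sum>k\<in>K. S * inverse bL * J k)"
    using assms(1-3) J0 by (intro sum_mono mult_right_mono mult_left_mono le_imp_inverse_le) auto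
  also have "\<dots> = S * inverse bL * (LINT t|lebesgue. (cmod (f t))\<^sup>2 * (\<Sum>k\<in>K. w k t))"
    using fw_int unfolding J_def sum_distrib_left[symmetric]
    by (simp add: sum_distrib_left Bochner_Integration.integral_sum)
  also have "\<dots> \<le> S * inverse bL * (LINT t|lebesgue. (cmod (f t))\<^sup>2 * S')"
  proof (intro mult_left_mono integral_mono)
    show "integrable lebesgue (\<lambda>t. (cmod (f t))\<^sup>2 * (\<Sum>k\<in>K. w k t))"
      using fw_int by (simp add: sum_distrib_left)
    show "(\<Sum>k\<in>K. w k t) \<le> S'" for t
      using S' fin by simp
  qed (use assms(1,3) f_int in auto)
  also have "\<dots> = inverse bL * S * S' * (L2_norm f)\<^sup>2"
    by (simp add: L2_norm_square)
  finally show ?thesis .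
qed

section \<open>Stability of frames under Bessel perturbations\<close>

text \<open>The triangle inequality is applied to finite partial sums in both directions. A Bessel
  bound on finite sets therefore suffices as hypothesis.\<close>

lemma is_frame_L2_perturbation:
  assumes frame: "is_frame_L2 e A B" and e': "\<And>i. e' i \<in> L2"
    and "0 \<le> R" "R < A"
    and bessel: "\<And>f F. f \<in> L2 \<Longrightarrow> finite F \<Longrightarrow>
       (\<Sum>i\<in>F. (cmod (L2_inner f (\<lambda>t. e' i t - e i t)))\<^sup>2) \<le> R * (L2_norm f)\<^sup>2"
  shows "is_frame_L2 e' ((sqrt A - sqrt R)\<^sup>2) ((sqrt B + sqrt R)\<^sup>2)"
proof -
  have AB: "0 < A" "A \<le> B" and e: "\<And>i. e i \<in> L2"
    using frame by (auto simp: is_frame_L2_def)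
  have RA: "sqrt R < sqrt A" using assms(4) by simp
  have "(\<lambda>i. (cmod (L2_inner f (e' i)))\<^sup>2) summable_on UNIV \<and>
        (sqrt A - sqrt R)\<^sup>2 * (L2_norm f)\<^sup>2 \<le> (\<Sum>\<^sub>\<infinity>i. (cmod (L2_inner f (e' i)))\<^sup>2) \<and>
        (\<Sum>\<^sub>\<infinity>i. (cmod (L2_inner f (e' i)))\<^sup>2) \<le> (sqrt B + sqrt R)\<^sup>2 * (L2_norm f)\<^sup>2"
    if f: "f \<in> L2" for f
  proof -
    define x where "x i = cmod (L2_inner f (e i))" for i
    define y where "y i = cmod (L2_inner f (e' i))" for i
    define z where "z i = cmod (L2_inner f (\<lambda>t. e' i t - e i t))" for i
    define N where "N = L2_norm f"
    have N0: "0 \<le> N" by (simp add: N_def L2_norm_nonneg)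
    have sx: "(\<lambda>i. (x i)\<^sup>2) summable_on UNIV" and xA: "A * N\<^sup>2 \<le> (\<Sum>\<^sub>\<infinity>i. (x i)\<^sup>2)"
      and xB: "(\<Sum>\<^sub>\<infinity>i. (x i)\<^sup>2) \<le> B * N\<^sup>2"
      using frame f by (auto simp: is_frame_L2_def x_def N_def)
    have diff: "L2_inner f (\<lambda>t. e' i t - e i t) = L2_inner f (e' i) - L2_inner f (e i)" for i
      by (rule L2_inner_diff_right[OF f e' e])
    have xyz: "x i \<le> y i + z i" and yxz: "y i \<le> x i + z i" for i
      unfolding x_def y_def z_def diff
      using norm_triangle_sub[of "L2_inner f (e' i)" "L2_inner f (e i)"]
        norm_triangle_sub[of "L2_inner f (e i)" "L2_inner f (e' i)"]
      by (simp_all add: norm_minus_commute)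
    have pos: "0 \<le> x i" "0 \<le> y i" "0 \<le> z i" for i
      by (simp_all add: x_def y_def z_def)
    have Lz: "L2_set z F \<le> sqrt R * N" if "finite F" for F
    proof -
      have "L2_set z F \<le> sqrt (R * N\<^sup>2)"
        unfolding L2_set_def z_def N_def by (intro real_sqrt_le_mono bessel[OF f that])
      then show ?thesis using N0 by (simp add: real_sqrt_mult)
    qed
    have Lx: "L2_set x F \<le> sqrt B * N" if "finite F" for F
    proof -
      have "(\<Sum>i\<in>F. (x i)\<^sup>2) \<le> B * N\<^sup>2"
        using finite_sum_le_infsum[OF sx that] xB by simp
      then have "L2_set x F \<le> sqrt (B * N\<^sup>2)" by (simp add: L2_set_def)
      then show ?thesis using N0 by (simp add: real_sqrt_mult)
    qed
    \<comment> \<open>The upper bound comes first: being uniform in \<open>F\<close>, it gives the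
      summability of the new coefficients, without which \<open>Y\<close> would carry no information
      in the lower bound.\<close>
    have Ly: "(\<Sum>i\<in>F. (y i)\<^sup>2) \<le> (sqrt B + sqrt R)\<^sup>2 * N\<^sup>2" if "finite F" for F
    proof -
      have "L2_set y F \<le> L2_set (\<lambda>i. x i + z i) F"
        using yxz pos by (intro L2_set_mono) auto
      also have "\<dots> \<le> L2_set x F + L2_set z F" by (rule L2_set_triangle_ineq)
      also have "\<dots> \<le> (sqrt B + sqrt R) * N"
        using Lx[OF that] Lz[OF that] by (simp add: algebra_simps)
      finally have "(L2_set y F)\<^sup>2 \<le> ((sqrt B + sqrt R) * N)\<^sup>2"
        by (intro power_mono L2_set_nonneg)
      then show ?thesis by (simp add: L2_set_def sum_nonneg power_mult_distrib)
    qed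
    have sy: "(\<lambda>i. (y i)\<^sup>2) summable_on UNIV"
      by (rule nonneg_bdd_above_summable_on) (auto intro!: bdd_aboveI2 Ly)
    define Y where "Y = (\<Sum>\<^sub>\<infinity>i. (y i)\<^sup>2)"
    have Y0: "0 \<le> Y" unfolding Y_def by (rule infsum_nonneg) simp
    have "(\<Sum>i\<in>F. (x i)\<^sup>2) \<le> (sqrt Y + sqrt R * N)\<^sup>2" if "finite F" for F
    proof -
      have "L2_set x F \<le> L2_set (\<lambda>i. y i + z i) F"
        using xyz pos by (intro L2_set_mono) auto
      also have "\<dots> \<le> L2_set y F + L2_set z F" by (rule L2_set_triangle_ineq)
      also have "\<dots> \<le> sqrt Y + sqrt R * N"
      proof (rule add_mono[OF _ Lz[OF that]])
        show "L2_set y F \<le> sqrt Y"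
          using finite_sum_le_infsum[OF sy that] by (simp add: L2_set_def Y_def)
      qed
      finally have "(L2_set x F)\<^sup>2 \<le> (sqrt Y + sqrt R * N)\<^sup>2"
        by (intro power_mono L2_set_nonneg)
      then show ?thesis by (simp add: L2_set_def sum_nonneg)
    qed
    then have "(\<Sum>\<^sub>\<infinity>i. (x i)\<^sup>2) \<le> (sqrt Y + sqrt R * N)\<^sup>2"
      by (intro infsum_le_finite_sums[OF sx])
    with xA have "A * N\<^sup>2 \<le> (sqrt Y + sqrt R * N)\<^sup>2" by simp
    then have "sqrt (A * N\<^sup>2) \<le> sqrt ((sqrt Y + sqrt R * N)\<^sup>2)" by (rule real_sqrt_le_mono)
    then have "sqrt A * N \<le> sqrt Y + sqrt R * N"
      using N0 Y0 assms(3) by (simp add: real_sqrt_mult)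
    then have "(sqrt A - sqrt R) * N \<le> sqrt Y" by (simp add: algebra_simps)
    \<comment> \<open>Squaring preserves the inequality because \<open>R < A\<close> makes the left
      factor positive.\<close>
    then have "((sqrt A - sqrt R) * N)\<^sup>2 \<le> (sqrt Y)\<^sup>2"
      using RA N0 by (intro power_mono) auto
    then have "(sqrt A - sqrt R)\<^sup>2 * N\<^sup>2 \<le> Y" using Y0 by (simp add: power_mult_distrib)
    moreover have "Y \<le> (sqrt B + sqrt R)\<^sup>2 * N\<^sup>2"
      unfolding Y_def by (intro infsum_le_finite_sums[OF sy] Ly)
    ultimately show ?thesis using sy by (simp add: Y_def y_def N_def)
  qed
  moreover have "(sqrt A - sqrt R)\<^sup>2 \<le> (sqrt B + sqrt R)\<^sup>2"
  proof (rule power_mono)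
    show "sqrt A - sqrt R \<le> sqrt B + sqrt R"
      using AB(2) assms(3) by (smt (verit) real_sqrt_ge_zero real_sqrt_le_mono)
  qed (use RA in simp)
  ultimately show ?thesis
    using e' RA by (simp add: is_frame_L2_def)
qed

section \<open>Application to polynomially decaying perturbations of windows\<close>

theorem proposition3p7:
  fixes bL bU pL pU CL CU \<delta> Ah Bh E1 E2 lam :: real
    and a b p C :: "int \<Rightarrow> real"
    and g h :: "int \<Rightarrow> real \<Rightarrow> complex"
  assumes "0 < bL" "bL \<le> bU"
    and "1 < pL" "pL \<le> pU"
    and "0 < CL" "CL \<le> CU"
    and "\<And>k. b k \<in> {bL..bU}"
    and "\<And>k. p k \<in> {pL..pU}"
    and "\<And>k. C k \<in> {CL..CU}"
    and "0 < \<delta>" "separated \<delta> a"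
    and "\<And>k. h k \<in> L2"
    and "is_frame_L2 (nonstat_gabor_system h b) Ah Bh"
    and "\<And>k. g k \<in> L2"
    and "\<And>k. AE t in lebesgue. cmod (g k t - h k t) \<le> C k * (1 + \<bar>t - a k\<bar>) powr (- p k)"
    and "E1 = 1 + (inverse \<delta> + pL) / ((1 + \<delta>) powr pL * (pL - 1))"
    and "E2 = 1 + (bU + pU) / ((1 + inverse bU) powr pL * (pL - 1))"
    and "lam = 4 * inverse bL * E1 * E2"
    and "CU < sqrt (Ah * inverse lam)"
  shows "is_frame_L2 (nonstat_gabor_system g b)
           (Ah * (1 - sqrt (CU\<^sup>2 * lam * inverse Ah))\<^sup>2)
           (Bh * (1 + sqrt (CU\<^sup>2 * lam * inverse Bh))\<^sup>2)"
proof -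
  define R where "R = CU\<^sup>2 * lam"
  \<comment> \<open>The largest constant and the slowest decay give one profile for all
    \<open>k\<close>; smaller exponents only increase the power since its base is at least
    1.\<close>
  define w where "w k t = CU * (1 + \<bar>t - a k\<bar>) powr (- pL)" for k t
  have "0 < bU" "0 < CU" using assms(1,2,5,6) by auto
  have AB: "0 < Ah" "0 < Bh" using assms(13) by (auto simp: is_frame_L2_def)
  have E1: "E1 = decay_const \<delta> pL" by (simp add: assms(16) decay_const_def)
  \<comment> \<open>Only an inequality holds: \<open>E2\<close> has \<open>pU\<close> in the
    numerator where \<open>decay_const\<close> has \<open>pL\<close>.\<close>
  have E2: "decay_const (inverse bU) pL \<le> E2"
    unfolding assms(17) decay_const_def using assms(3,4)
    by (intro add_left_mono divide_right_mono) auto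
  have E_pos: "0 < E1" "0 < E2"
    using assms(3,4,10) \<open>0 < bU\<close> unfolding assms(16,17) by (auto intro!: add_pos_nonneg)
  then have "0 < lam" unfolding assms(18) using assms(1) by simp
  have "CU\<^sup>2 < (sqrt (Ah * inverse lam))\<^sup>2"
    using assms(19) \<open>0 < CU\<close> by (intro power_strict_mono) auto
  then have "R < Ah"
    using AB(1) \<open>0 < lam\<close> by (simp add: R_def field_simps)
  have "0 \<le> R" using \<open>0 < lam\<close> by (simp add: R_def)

  have w_cont: "continuous_on UNIV (w k)" for k
    unfolding w_def by (intro continuous_intros) (auto simp: add_pos_nonneg less_imp_neq[symmetric])
  have w_nonneg: "0 \<le> w k t" for k t
    using \<open>0 < CU\<close> by (simp add: w_def)
  have w_centres: "(\<Sum>k\<in>K. w k t) \<le> CU * (2 * E1)" if "finite K" for K t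
    unfolding w_def sum_distrib_left[symmetric] E1
    using that assms(3,10,11) \<open>0 < CU\<close>
    by (intro mult_left_mono sum_decay_separated) (auto simp: separated_def less_imp_le)
  \<comment> \<open>Translating the argument by n / b_k amounts to moving the centre to a_k - n /
    b_k. These centres are at least 1 / b_k, hence at least 1 / bU, apart.\<close>
  have w_period: "(\<Sum>n\<in>N. w k (t + of_int n * inverse (b k))) \<le> CU * (2 * E2)"
    if "finite N" for N :: "int set" and k t
  proof -
    have bk: "0 < b k" "b k \<le> bU" using assms(1) assms(7)[of k] by auto
    have "(\<Sum>n\<in>N. (1 + \<bar>t - (a k - of_int n * inverse (b k))\<bar>) powr (- pL))
        \<le> 2 * decay_const (inverse bU) pL"
    proof (rule sum_decay_separated)
      fix n m :: int
      assume "n \<noteq> m"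
      then have "1 \<le> \<bar>real_of_int (m - n)\<bar>" by linarith
      then have "1 * inverse (b k) \<le> \<bar>real_of_int (m - n)\<bar> * inverse (b k)"
        using bk by (intro mult_right_mono) auto
      moreover have "inverse bU \<le> inverse (b k)"
        using bk by (intro le_imp_inverse_le) auto
      ultimately have "inverse bU \<le> \<bar>real_of_int (m - n) * inverse (b k)\<bar>"
        using bk by (simp only: abs_mult abs_inverse abs_of_pos mult_1_left)
      then show "inverse bU \<le> \<bar>a k - of_int n * inverse (b k) - (a k - of_int m * inverse (b k))\<bar>"
        by (simp add: algebra_simps)
    qed (use that assms(3) \<open>0 < bU\<close> in auto)
    then have "CU * (\<Sum>n\<in>N. (1 + \<bar>t - (a k - of_int n * inverse (b k))\<bar>) powr (- pL)) \<le> CU * (2 * E2)"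
      using E2 \<open>0 < CU\<close> by (intro mult_left_mono) auto
    then show ?thesis by (simp add: w_def sum_distrib_left algebra_simps)
  qed
  have dom: "AE t in lebesgue. cmod (g k t - h k t) \<le> w k t" for k
    using assms(15)[of k]
  proof eventually_elim
    fix t assume t: "cmod (g k t - h k t) \<le> C k * (1 + \<bar>t - a k\<bar>) powr (- p k)"
    have "C k * (1 + \<bar>t - a k\<bar>) powr (- p k) \<le> w k t"
      unfolding w_def using assms(8,9)[of k] \<open>0 < CU\<close>
      by (intro mult_mono powr_mono) auto
    with t show "cmod (g k t - h k t) \<le> w k t" by simp
  qed

  have "is_frame_L2 (nonstat_gabor_system g b) ((sqrt Ah - sqrt R)\<^sup>2) ((sqrt Bh + sqrt R)\<^sup>2)"
  proof (rule is_frame_L2_perturbation[OF assms(13) _ \<open>0 \<le> R\<close> \<open>R < Ah\<close>])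
    show "nonstat_gabor_system g b i \<in> L2" for i
      using assms(14) by (auto simp: nonstat_gabor_system_def modulation_in_L2 split: prod.split)
    fix f and F :: "(int \<times> int) set"
    assume f: "f \<in> L2" and F: "finite F"
    have "(\<Sum>i\<in>F. (cmod (L2_inner f (\<lambda>t. nonstat_gabor_system g b i t - nonstat_gabor_system h b i t)))\<^sup>2)
        = (\<Sum>(k, l)\<in>F. (cmod (L2_inner f (modulation (b k * of_int l) (\<lambda>t. g k t - h k t))))\<^sup>2)"
      by (intro sum.cong) (auto simp: nonstat_gabor_system_def modulation_diff)
    \<comment> \<open>The two factors 2 and the two factors \<open>CU\<close> combine with
      \<open>inverse bL\<close>, \<open>E1\<close> and \<open>E2\<close> to exactly
      \<open>R\<close>.\<close>
    also have "\<dots> \<le> inverse bL * (CU * (2 * E2)) * (CU * (2 * E1)) * (L2_norm f)\<^sup>2"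
      by (rule modulates_bessel_family[where w = w])
        (use assms(1,7,12,14) f F \<open>0 < CU\<close> E_pos L2_diff w_cont w_nonneg w_period w_centres dom in auto)
    also have "\<dots> = R * (L2_norm f)\<^sup>2"
      by (simp add: R_def assms(18) power2_eq_square)
    finally show "(\<Sum>i\<in>F. (cmod (L2_inner f
        (\<lambda>t. nonstat_gabor_system g b i t - nonstat_gabor_system h b i t)))\<^sup>2) \<le> R * (L2_norm f)\<^sup>2" .
  qed
  \<comment> \<open>Factoring out \<open>sqrt Ah\<close>, and likewise \<open>sqrt Bh\<close> below,
    brings the bounds into the stated form.\<close>
  moreover have "(sqrt Ah - sqrt R)\<^sup>2 = Ah * (1 - sqrt (R * inverse Ah))\<^sup>2"
  proof -
    have "sqrt Ah - sqrt R = sqrt Ah * (1 - sqrt (R * inverse Ah))"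
      using AB by (simp add: algebra_simps real_sqrt_mult[symmetric])
    then show ?thesis using AB by (simp add: power_mult_distrib)
  qed
  moreover have "(sqrt Bh + sqrt R)\<^sup>2 = Bh * (1 + sqrt (R * inverse Bh))\<^sup>2"
  proof -
    have "sqrt Bh + sqrt R = sqrt Bh * (1 + sqrt (R * inverse Bh))"
      using AB by (simp add: algebra_simps real_sqrt_mult[symmetric])
    then show ?thesis using AB by (simp add: power_mult_distrib)
  qed
  ultimately show ?thesis by (simp add: R_def)
qed

end
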